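(* Let $k \ge 3$, let $A_1, \ldots, A_k \in \mathbb{N}$, and let $n = 1 + \sum_{i=1}^k A_i$ be the number of vertices of the starlike tree $\mathrm{S}(A_1, A_2, \ldots, A_k)$. Let $$\alpha_{ij} = (n - 1 - A_i - A_j)(A_j - A_i) \qquad (1 \le i, j \le k).$$ The tree $\mathrm{S}(A_1, A_2, \ldots, A_k)$ is transmission irregular if and only if all of the following conditions hold: (i) the values $A_1, A_2, \ldots, A_k$ are mutually distinct; (ii) $A_i < \frac{n}{2}$ for each $1 \le i \le k$; (iii) for all $1 \le i < j \le k$, the number $\alpha_{ij}$ does not have a positive divisor $p \in \mathbb{N}$, $p > \sqrt{|\alpha_{ij}|}$, such that all of the following are satisfied: (a) $p$ and $\frac{\alpha_{ij}}{p}$ are of the same parity if and only if $2 \nmid n$; (b) $g(\alpha_{ij}, n + 1 - 2A_i) \le p \le g(\alpha_{ij}, n-1)$; (c) $g(\alpha_{ji}, n + 1 - 2A_j) \le p \le g(\alpha_{ji}, n-1)$.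
   Context: $\mathbb{N}$ denotes the positive integers. For a simple connected graph $G$, the transmission of a vertex $u$ is $\mathrm{Tr}_G(u) = \sum_{v \in V(G)} d_G(u,v)$, where $d_G$ is the graph distance. $G$ is transmission irregular (TI) if all its vertices have mutually distinct transmissions. A tree is starlike if it contains a single vertex $u$ of degree greater than two. $\mathrm{S}(A_1, \ldots, A_k)$ (with $k \ge 3$ and $A_i \in \mathbb{N}$) denotes the starlike tree in which $u$ has degree $k$ and the $k$ pendent paths starting at $u$ have lengths (numbers of edges) $A_1, \ldots, A_k$. The function $g \colon \mathbb{R} \times (0, +\infty) \to \overline{\mathbb{R}}$ is defined by $g(C_1, C_2) = \frac{1}{2}\left(C_2 + \sqrt{C_2^2 - 4C_1}\right)$ if $C_2^2 - 4C_1 \ge 0$, and $g(C_1, C_2) = -\infty$ if $C_2^2 - 4C_1 < 0$. (When condition (ii) holds, all second arguments of $g$ appearing in (iii) are positive.) *)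

theory Defs
  imports Complex_Main "HOL-Library.Extended_Real" "Graph_Theory.Graph_Theory"
begin

text \<open>
  A finite simple graph is a \<^locale>\<open>pair_graph\<close>, each edge being represented by its two
  opposite arcs.  The graph distance is the library's shortest-path distance for unit arc
  weights, so it and the transmission take values in \<^typ>\<open>ereal\<close>; for connected graphs
  both are finite.
\<close>

definition gdist :: "'a pair_pre_digraph \<Rightarrow> 'a \<Rightarrow> 'a \<Rightarrow> ereal" where
  "gdist G u v = wf_digraph.\<mu> (with_proj G) (\<lambda>_. 1) u v"

definition transmission :: "'a pair_pre_digraph \<Rightarrow> 'a \<Rightarrow> ereal" where
  "transmission G u = (\<Sum>v\<in>pverts G. gdist G u v)"

definition transmission_irregular :: "'a pair_pre_digraph \<Rightarrow> bool" where
  "transmission_irregular G \<longleftrightarrow> inj_on (transmission G) (pverts G)"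

text \<open>
  In the starlike tree, \<open>Pend i j\<close> is the vertex of the \<open>i\<close>-th pendent path at distance \<open>j\<close>
  from the centre.  Only \<open>A 1, \<dots>, A k\<close> are used.
\<close>

datatype svertex = Centre | Pend nat nat

definition starlike_arcs :: "nat \<Rightarrow> (nat \<Rightarrow> nat) \<Rightarrow> svertex rel" where
  "starlike_arcs k A =
     {(Centre, Pend i 1) | i. i \<in> {1..k} \<and> 1 \<le> A i} \<union>
     {(Pend i j, Pend i (Suc j)) | i j. i \<in> {1..k} \<and> 1 \<le> j \<and> Suc j \<le> A i}"

definition starlike :: "nat \<Rightarrow> (nat \<Rightarrow> nat) \<Rightarrow> svertex pair_pre_digraph" where
  "starlike k A =
     \<lparr> pverts = insert Centre {Pend i j | i j. i \<in> {1..k} \<and> j \<in> {1..A i}},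
       parcs = starlike_arcs k A \<union> (starlike_arcs k A)\<inverse> \<rparr>"

text \<open>Only meant for \<open>C2 > 0\<close>.\<close>

definition g :: "real \<Rightarrow> real \<Rightarrow> ereal" where
  "g C1 C2 = (if C2\<^sup>2 - 4 * C1 \<ge> 0
              then ereal (1 / 2 * (C2 + sqrt (C2\<^sup>2 - 4 * C1)))
              else - \<infinity>)"


text \<open>Sanity checks: the construction yields a connected simple graph of the expected order
  in which the centre has degree \<open>k\<close>.\<close>

lemma pverts_starlike:
  "pverts (starlike k A) = insert Centre ((\<lambda>(i, j). Pend i j) ` (SIGMA i:{1..k}. {1..A i}))"
  by (auto simp: starlike_def)

lemma card_pverts_starlike: "card (pverts (starlike k A)) = 1 + (\<Sum>i=1..k. A i)"
proof -
  have "inj_on (\<lambda>(i, j). Pend i j) (SIGMA i:{1..k}. {1..A i})"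
    by (auto simp: inj_on_def)
  then show ?thesis
    unfolding pverts_starlike by (subst card_insert_disjoint) (auto simp: card_image)
qed

lemma pair_graph_starlike: "pair_graph (starlike k A)"
proof -
  let ?G = "starlike k A"
  have fin: "finite (pverts ?G)"
    unfolding pverts_starlike by auto
  have sub: "parcs ?G \<subseteq> pverts ?G \<times> pverts ?G"
    by (auto simp: starlike_def starlike_arcs_def)
  have "sym (parcs ?G)"
    by (auto simp: starlike_def sym_def)
  then have "symmetric (with_proj ?G)"
    by (simp add: symmetric_def)
  moreover have "fst e \<noteq> snd e" if "e \<in> parcs ?G" for e
    using that by (auto simp: starlike_def starlike_arcs_def)
  ultimately show ?thesis
    using fin sub finite_subset[OF sub] by unfold_locales auto
qed

lemma connected_starlike: "connected (with_proj (starlike k A))"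
proof -
  let ?G = "starlike k A"
  interpret pair_graph ?G by (rule pair_graph_starlike)
  have reach: "Centre \<rightarrow>\<^sup>*\<^bsub>with_proj ?G\<^esub> Pend i (Suc j)" if "i \<in> {1..k}" "Suc j \<le> A i" for i j
    using that
  proof (induction j)
    case 0
    then have "(Centre, Pend i 1) \<in> parcs ?G"
      by (auto simp: starlike_def starlike_arcs_def)
    then show ?case by auto
  next
    case (Suc j)
    then have "(Pend i (Suc j), Pend i (Suc (Suc j))) \<in> parcs ?G"
      by (auto simp: starlike_def starlike_arcs_def)
    with Suc show ?case
      by (meson Suc_leD reachable_adj_trans with_proj_simps(3))
  qed
  have "Centre \<rightarrow>\<^sup>*\<^bsub>with_proj ?G\<^esub> v" if "v \<in> pverts ?G" for v
  proof (cases v)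
    case Centre
    with that show ?thesis by auto
  next
    case (Pend i j)
    then show ?thesis using that reach[of i "j - 1"] by (auto simp: starlike_def)
  qed
  then have "u \<rightarrow>\<^sup>*\<^bsub>with_proj ?G\<^esub> v" if "u \<in> pverts ?G" "v \<in> pverts ?G" for u v
    using that by (meson reachable_trans symmetric_reachable')
  then show ?thesis
    by (intro connectedI) (auto simp: pverts_starlike intro: reachable_mk_symmetricI)
qed

lemma degree_Centre_starlike:
  assumes "\<And>i. i \<in> {1..k} \<Longrightarrow> A i \<ge> 1"
  shows "out_degree (with_proj (starlike k A)) Centre = k"
proof -
  have "out_arcs (with_proj (starlike k A)) Centre = (\<lambda>i. (Centre, Pend i 1)) ` {1..k}"
    using assms by (auto simp: out_arcs_def starlike_def starlike_arcs_def)
  then show ?thesis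
    by (simp add: out_degree_def card_image inj_on_def)
qed

end

theory Submission
  imports Defs
begin

text \<open>
  Stepping one edge outwards along a pendent path of length \<open>a\<close>, from depth \<open>x\<close> to depth
  \<open>x + 1\<close>, brings the \<open>a - x\<close> vertices beyond that edge one step closer and moves all others
  one step away, so the transmission grows by \<open>n - 2 * (a - x)\<close>.  Adding these increments, a
  vertex at depth \<open>x\<close> exceeds the transmission of the centre by
  \<open>x * (x + n - 1 - 2 * a)\<close>, whatever the other paths are; this is \<open>sum_tree_dist\<close>.  Transmission
  irregularity is thus the injectivity of an explicit family of quadratics, and three sorts of
  coincidences have to be excluded.

  On a single path (the centre being depth \<open>0\<close>) the quadratic is injective exactly when its
  second root \<open>2 * a + 1 - n\<close> is not a positive depth, that is, when \<open>2 * a < n\<close>.  Two paths of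
  equal length carry equal transmissions.  For paths of lengths \<open>a\<close> and \<open>b\<close>,
  complete the squares: with \<open>X = 2 * x + n - 1 - 2 * a\<close> and \<open>Y = 2 * y + n - 1 - 2 * b\<close>, the
  transmissions at depths \<open>x\<close> and \<open>y\<close> agree iff
  \<open>X\<^sup>2 - Y\<^sup>2 = 4 * \<alpha>\<close> with \<open>\<alpha> = (n - 1 - a - b) * (b - a)\<close>.  Putting \<open>X = p + q\<close> and
  \<open>Y = p - q\<close> turns a coincidence into a factorisation \<open>\<alpha> = p * q\<close>
  (\<open>collision_iff_factorisation\<close>).  The positivity of \<open>X\<close> and \<open>Y\<close> becomes \<open>\<bar>q\<bar> < p\<close>, i.e.
  \<open>p > sqrt \<bar>\<alpha>\<bar>\<close>; that \<open>X\<close> and \<open>Y\<close> have the parity of \<open>n - 1\<close> becomes the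
  parity condition; and the ranges of \<open>x\<close> and \<open>y\<close> become bounds on \<open>p + \<alpha> / p\<close> and
  \<open>p - \<alpha> / p\<close>.  As \<open>t + C1 / t\<close> is increasing for \<open>t > sqrt \<bar>C1\<bar>\<close>, and \<open>g C1 C2\<close> is the larger
  real solution \<open>t\<close> of \<open>t + C1 / t = C2\<close>, or \<open>- \<infinity>\<close> if there is none, these are the stated bounds on \<open>p\<close> itself (\<open>g_le_iff\<close>,
  \<open>le_g_iff\<close>).
\<close>

section \<open>Graph distances from a potential\<close>

text \<open>
  The Lipschitz condition bounds the length of every walk from below, and following the descent
  from \<open>v\<close> back to \<open>u\<close> yields a walk attaining the bound.  This replaces any discussion of which
  walks in a tree are shortest by two local checks on arcs.
\<close>

lemma (in wf_digraph) mu_unit_eq_potential: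
  fixes d :: "'a \<Rightarrow> nat"
  assumes u: "u \<in> verts G" "d u = 0"
    and lipschitz: "\<And>e. e \<in> arcs G \<Longrightarrow> d (head G e) \<le> Suc (d (tail G e))"
    and descent: "\<And>v. v \<in> verts G \<Longrightarrow> v \<noteq> u \<Longrightarrow>
                    \<exists>e\<in>arcs G. head G e = v \<and> d v = Suc (d (tail G e))"
    and v: "v \<in> verts G"
  shows "\<mu> (\<lambda>_. 1) u v = ereal (real (d v))"
proof (rule antisym)
  have cost: "awalk_cost (\<lambda>_. 1) p = real (length p)" for p :: "'b list"
    by (induction p) auto
  have "\<exists>p. awalk u p v \<and> length p = d v"
    using v
  proof (induction "d v" arbitrary: v rule: less_induct)
    case less
    show ?case
    proof (cases "v = u")
      case True
      then show ?thesis using u by (intro exI[of _ "[]"]) (auto simp: awalk_Nil_iff)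
    next
      case False
      with less.prems descent obtain e
        where e: "e \<in> arcs G" "head G e = v" "d v = Suc (d (tail G e))" by blast
      then obtain p where "awalk u p (tail G e)" "length p = d (tail G e)"
        using less.hyps[of "tail G e"] by auto
      moreover have "awalk (tail G e) [e] v"
        using e by (auto simp: awalk_simps)
      ultimately show ?thesis
        using e by (intro exI[of _ "p @ [e]"]) (auto intro: awalk_appendI)
    qed
  qed
  then show "\<mu> (\<lambda>_. 1) u v \<le> ereal (real (d v))"
    using min_cost_le_walk_cost[where c="\<lambda>_. 1"] cost by metis
  have "d w \<le> d x + length p" if "awalk x p w" for x p w
    using that
  proof (induction p arbitrary: x)
    case (Cons e p)
    then have "d w \<le> d (head G e) + length p" "e \<in> arcs G" "tail G e = x"
      by (auto simp: awalk_Cons_iff)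
    with lipschitz[of e] show ?case by auto
  qed (auto simp: awalk_Nil_iff)
  with u have "d v \<le> length p" if "awalk u p v" for p
    using that by fastforce
  then show "ereal (real (d v)) \<le> \<mu> (\<lambda>_. 1) u v"
    unfolding \<mu>_def cost by (auto intro!: INF_greatest)
qed


section \<open>Transmissions in a starlike tree\<close>

fun tree_dist :: "svertex \<Rightarrow> svertex \<Rightarrow> nat" where
  "tree_dist Centre Centre = 0"
| "tree_dist Centre (Pend j y) = y"
| "tree_dist (Pend i x) Centre = x"
| "tree_dist (Pend i x) (Pend j y) = (if i = j then (x - y) + (y - x) else x + y)"

lemma tree_dist_self: "tree_dist u u = 0"
  by (cases u) auto

lemma tree_dist_arc:
  assumes "(v, w) \<in> parcs (starlike k A)"
  shows "tree_dist u w \<le> Suc (tree_dist u v)"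
  using assms by (cases u) (auto simp: starlike_def starlike_arcs_def)

lemma tree_dist_descent:
  assumes "u \<in> pverts (starlike k A)" "v \<in> pverts (starlike k A)" "v \<noteq> u"
  shows "\<exists>w. (w, v) \<in> parcs (starlike k A) \<and> tree_dist u v = Suc (tree_dist u w)"
proof (cases v)
  case Centre
  with assms obtain i x where u: "u = Pend i x" "i \<in> {1..k}" "x \<in> {1..A i}"
    by (auto simp: starlike_def)
  then show ?thesis
    using Centre by (intro exI[of _ "Pend i 1"]) (auto simp: starlike_def starlike_arcs_def)
next
  case (Pend j y)
  with assms have j: "j \<in> {1..k}" "y \<in> {1..A j}"
    by (auto simp: starlike_def)
  \<comment> \<open>The neighbour of \<open>v\<close> nearest to \<open>u\<close> lies further out only if \<open>u\<close> is beyond \<open>v\<close> on the same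
    path; in all other cases it is the next vertex towards the centre.\<close>
  consider (outward) x where "u = Pend j x" "y < x" "x \<le> A j"
    | (inward) "\<not> (\<exists>x > y. u = Pend j x)"
    using assms by (auto simp: starlike_def)
  then show ?thesis
  proof cases
    case outward
    then show ?thesis
      using Pend j
      by (intro exI[of _ "Pend j (Suc y)"]) (auto simp: starlike_def starlike_arcs_def)
  next
    case inward
    show ?thesis
    proof (cases "y = 1")
      case True
      then show ?thesis
        using Pend j inward assms
        by (intro exI[of _ Centre], cases u) (auto simp: starlike_def starlike_arcs_def)
    next
      case False
      with j obtain z where z: "y = Suc z" "1 \<le> z"
        by (cases y) auto
      then show ?thesis
        using Pend j inward assms
        by (intro exI[of _ "Pend j z"], cases u)
          (auto simp: starlike_def starlike_arcs_def not_less_eq)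
    qed
  qed
qed

lemma gdist_starlike:
  assumes "u \<in> pverts (starlike k A)" "v \<in> pverts (starlike k A)"
  shows "gdist (starlike k A) u v = ereal (real (tree_dist u v))"
proof -
  interpret pair_graph "starlike k A" by (rule pair_graph_starlike)
  show ?thesis
    unfolding gdist_def
  proof (rule mu_unit_eq_potential[where d = "tree_dist u"])
    fix v assume "v \<in> pverts (starlike k A)" "v \<noteq> u"
    then obtain w where "(w, v) \<in> parcs (starlike k A)" "tree_dist u v = Suc (tree_dist u w)"
      using tree_dist_descent[OF assms(1), of v] by auto
    then show "\<exists>e\<in>parcs (starlike k A). snd e = v \<and> tree_dist u v = Suc (tree_dist u (fst e))"
      by (intro bexI[of _ "(w, v)"]) auto
  qed (use assms tree_dist_arc in \<open>auto simp: tree_dist_self\<close>)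
qed

text \<open>
  The amount by which a vertex at depth \<open>x\<close> of a pendent path of length \<open>a\<close>, in a starlike tree
  on \<open>n\<close> vertices, exceeds the centre in transmission.  It is taken over the integers because it
  is negative for small positive \<open>x\<close> when \<open>a\<close> is large.
\<close>

definition excess :: "int \<Rightarrow> int \<Rightarrow> int \<Rightarrow> int" where
  "excess n a x = x * (x + n - 1 - 2 * a)"

text \<open>
  The contribution of the vertex's own path to its excess: each \<open>y > x\<close> contributes \<open>- x\<close>, and each
  \<open>y \<le> x\<close> contributes \<open>x - 2 * y\<close>.
\<close>

lemma sum_dist_path:
  "x \<le> a \<Longrightarrow> (\<Sum>y=1..a. \<bar>int x - int y\<bar> - int y) = int x * (int x - int a - 1)"
proof (induction a rule: dec_induct)
  case base
  have "(\<Sum>y=1..m. int x - 2 * int y) = int m * (int x - int m - 1)" for m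
    by (induction m) (auto simp: algebra_simps)
  moreover have "(\<Sum>y=1..x. \<bar>int x - int y\<bar> - int y) = (\<Sum>y=1..x. int x - 2 * int y)"
    by (rule sum.cong) auto
  ultimately show ?case by simp
qed (auto simp: algebra_simps)

text \<open>
  Subtracting the distances from the centre term by term, each vertex off the \<open>i\<close>-th path
  contributes exactly \<open>x\<close>, so only the number of such vertices matters, not how they are spread
  over the other paths.
\<close>

lemma sum_tree_dist:
  assumes "i \<in> {1..k}" "x \<le> A i" "n = 1 + (\<Sum>i=1..k. A i)"
  shows "(\<Sum>v\<in>pverts (starlike k A). int (tree_dist (Pend i x) v)) =
         (\<Sum>v\<in>pverts (starlike k A). int (tree_dist Centre v)) + excess (int n) (int (A i)) (int x)"
proof -
  let ?f = "\<lambda>v. int (tree_dist (Pend i x) v) - int (tree_dist Centre v)"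
  let ?S = "SIGMA i:{1..k}. {1..A i}"
  have inj: "inj_on (\<lambda>(i, j). Pend i j) ?S"
    by (auto simp: inj_on_def)
  have "sum ?f (pverts (starlike k A)) = ?f Centre + sum ?f ((\<lambda>(i, j). Pend i j) ` ?S)"
    unfolding pverts_starlike by (rule sum.insert) auto
  also have "sum ?f ((\<lambda>(i, j). Pend i j) ` ?S) = (\<Sum>(j, y)\<in>?S. ?f (Pend j y))"
    by (subst sum.reindex[OF inj]) (auto intro: sum.cong)
  also have "\<dots> = (\<Sum>j=1..k. \<Sum>y=1..A j. ?f (Pend j y))"
    by (rule sum.Sigma[symmetric]) auto
  also have "\<dots> = (\<Sum>y=1..A i. ?f (Pend i y)) + (\<Sum>j\<in>{1..k} - {i}. \<Sum>y=1..A j. ?f (Pend j y))"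
    using assms by (intro sum.remove) auto
  also have "(\<Sum>y=1..A i. ?f (Pend i y)) = (\<Sum>y=1..A i. \<bar>int x - int y\<bar> - int y)"
    by (rule sum.cong) auto
  also have "\<dots> = int x * (int x - int (A i) - 1)"
    by (rule sum_dist_path) fact
  also have "(\<Sum>j\<in>{1..k} - {i}. \<Sum>y=1..A j. ?f (Pend j y)) = (\<Sum>j\<in>{1..k} - {i}. int (A j) * int x)"
    by (rule sum.cong) auto
  also have "\<dots> = (int n - 1 - int (A i)) * int x"
    using assms by (simp add: sum_distrib_right[symmetric] sum_diff1)
  finally show ?thesis
    by (simp add: sum_subtractf excess_def algebra_simps)
qed

fun vertex_excess :: "nat \<Rightarrow> (nat \<Rightarrow> nat) \<Rightarrow> svertex \<Rightarrow> int" where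
  "vertex_excess n A Centre = 0"
| "vertex_excess n A (Pend i x) = excess (int n) (int (A i)) (int x)"

lemma transmission_irregular_iff_excess:
  assumes n: "n = 1 + (\<Sum>i=1..k. A i)"
  shows "transmission_irregular (starlike k A) \<longleftrightarrow>
         inj_on (vertex_excess n A) (pverts (starlike k A))"
proof -
  let ?V = "pverts (starlike k A)"
  define c where "c = (\<Sum>v\<in>?V. int (tree_dist Centre v))"
  have "transmission (starlike k A) u = ereal (real_of_int (c + vertex_excess n A u))"
    if u: "u \<in> ?V" for u
  proof -
    have "transmission (starlike k A) u = (\<Sum>v\<in>?V. ereal (real (tree_dist u v)))"
      unfolding transmission_def by (rule sum.cong) (auto simp: gdist_starlike u)
    also have "\<dots> = ereal (real_of_int (\<Sum>v\<in>?V. int (tree_dist u v)))"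
      by simp
    also have "(\<Sum>v\<in>?V. int (tree_dist u v)) = c + vertex_excess n A u"
    proof (cases u)
      case (Pend i x)
      with u have "i \<in> {1..k}" "x \<le> A i"
        by (auto simp: starlike_def)
      with sum_tree_dist[OF this n] Pend show ?thesis
        by (simp add: c_def)
    qed (simp add: c_def)
    finally show ?thesis .
  qed
  then show ?thesis
    unfolding transmission_irregular_def by (simp add: inj_on_def)
qed


section \<open>Collisions and divisors\<close>

text \<open>
  Two different depths have equal excess only if they add up to \<open>2 * a + 1 - n\<close>, which is at most
  \<open>0\<close> for a short path, whereas two different nonnegative depths have a positive sum.
\<close>

lemma excess_inj:
  assumes "2 * a < n" "0 \<le> x" "0 \<le> y" "excess n a x = excess n a y"
  shows "x = y"
proof (rule ccontr)
  assume "x \<noteq> y"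
  have "(x - y) * (x + y + n - 1 - 2 * a) = 0"
    using assms(4) by (simp add: excess_def algebra_simps)
  with \<open>x \<noteq> y\<close> have "x + y + n - 1 - 2 * a = 0" by simp
  with assms \<open>x \<noteq> y\<close> show False by linarith
qed

text \<open>
  Completing the squares in both terms; the constants left over differ by four times the product
  called \<open>\<alpha>\<close> above.
\<close>

lemma four_mul_excess_diff:
  "4 * (excess n a x - excess n b y) =
   (2 * x + n - 1 - 2 * a)\<^sup>2 - (2 * y + n - 1 - 2 * b)\<^sup>2 - 4 * ((n - 1 - a - b) * (b - a))"
  by (simp add: excess_def algebra_simps power2_eq_square)

text \<open>
  Write \<open>C1 = p * q\<close>, so that \<open>p + q = p + C1 / p\<close>.  The polynomial \<open>t\<^sup>2 - C * t + p * q\<close> takes the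
  value \<open>p * (p + q - C)\<close> at \<open>t = p\<close>.  The product of its roots is \<open>p * q < p\<^sup>2\<close>, so if they are real,
  the smaller one lies below \<open>p\<close>, and the sign of that value tells on which side of the larger one
  \<open>p\<close> lies.  If there are no real roots, then \<open>C\<^sup>2 < 4 * (p * q) \<le> (p + q)\<^sup>2\<close>, so \<open>C < p + q\<close>,
  in accordance with the value \<open>- \<infinity>\<close>.
\<close>

lemma g_le_iff:
  assumes "\<bar>q\<bar> < p"
  shows "g (p * q) C \<le> ereal p \<longleftrightarrow> C \<le> p + q"
proof (cases "C\<^sup>2 - 4 * (p * q) \<ge> 0")
  case D: True
  have sq: "(2 * p - C)\<^sup>2 - (C\<^sup>2 - 4 * (p * q)) = 4 * p * (p + q - C)"
    by (simp add: power2_eq_square algebra_simps)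
  have "g (p * q) C \<le> ereal p \<longleftrightarrow> sqrt (C\<^sup>2 - 4 * (p * q)) \<le> 2 * p - C"
    using D by (simp add: g_def) linarith
  also have "\<dots> \<longleftrightarrow> 0 \<le> 2 * p - C \<and> C\<^sup>2 - 4 * (p * q) \<le> (2 * p - C)\<^sup>2"
    using D by (meson order_trans real_le_lsqrt real_sqrt_ge_zero sqrt_le_D)
  also have "\<dots> \<longleftrightarrow> 0 \<le> 2 * p - C \<and> 0 \<le> 4 * p * (p + q - C)"
    using sq by linarith
  also have "\<dots> \<longleftrightarrow> C \<le> p + q"
    using assms by (auto simp: zero_le_mult_iff)
  finally show ?thesis .
next
  case D: False
  have "0 \<le> (p - q)\<^sup>2" by simp
  then have "C\<^sup>2 \<le> (p + q)\<^sup>2"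
    using D by (simp add: power2_eq_square algebra_simps)
  then have "C \<le> p + q"
    using power2_le_imp_le[of C "p + q"] assms by auto
  with D show ?thesis by (simp add: g_def)
qed

lemma le_g_iff:
  assumes "\<bar>q\<bar> < p"
  shows "ereal p \<le> g (p * q) C \<longleftrightarrow> p + q \<le> C"
proof (cases "C\<^sup>2 - 4 * (p * q) \<ge> 0")
  case D: True
  have sq: "(2 * p - C)\<^sup>2 - (C\<^sup>2 - 4 * (p * q)) = 4 * p * (p + q - C)"
    by (simp add: power2_eq_square algebra_simps)
  have "ereal p \<le> g (p * q) C \<longleftrightarrow> 2 * p - C \<le> sqrt (C\<^sup>2 - 4 * (p * q))"
    using D by (simp add: g_def) linarith
  also have "\<dots> \<longleftrightarrow> 2 * p - C < 0 \<or> (2 * p - C)\<^sup>2 \<le> C\<^sup>2 - 4 * (p * q)"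
    using D by (smt (verit) real_le_rsqrt real_sqrt_ge_zero real_sqrt_le_iff real_sqrt_abs)
  also have "\<dots> \<longleftrightarrow> 2 * p - C < 0 \<or> 4 * p * (p + q - C) \<le> 0"
    using sq by linarith
  also have "\<dots> \<longleftrightarrow> p + q \<le> C"
    using assms by (auto simp: mult_le_0_iff)
  finally show ?thesis .
next
  case D: False
  have "0 \<le> (p - q)\<^sup>2" by simp
  then have "C\<^sup>2 < (p + q)\<^sup>2"
    using D by (simp add: power2_eq_square algebra_simps)
  then have "C < p + q"
    using power2_less_imp_less[of C "p + q"] assms by auto
  with D show ?thesis by (simp add: g_def)
qed

lemma sqrt_abs_mult_less_iff:
  fixes p q :: real
  assumes "0 < p"
  shows "sqrt \<bar>p * q\<bar> < p \<longleftrightarrow> \<bar>q\<bar> < p"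
proof -
  have "sqrt \<bar>p * q\<bar> < p \<longleftrightarrow> sqrt \<bar>p * q\<bar> < sqrt (p * p)"
    using assms by simp
  also have "\<dots> \<longleftrightarrow> \<bar>q\<bar> < p"
    using assms unfolding real_sqrt_less_iff by (simp add: abs_mult)
  finally show ?thesis .
qed

text \<open>
  The substitution is \<open>p + q = 2 * x + n - 1 - 2 * a\<close>, \<open>p - q = 2 * y + n - 1 - 2 * b\<close>.  Since both
  right-hand sides have the same parity, it is solvable for \<open>p\<close> and \<open>q\<close>; conversely, the parity
  condition is what makes it solvable for \<open>x\<close> and \<open>y\<close>.
\<close>

lemma collision_iff_factorisation:
  fixes n a b :: int
  assumes ab: "2 * a < n" "2 * b < n"
  shows "(\<exists>x\<in>{1..a}. \<exists>y\<in>{1..b}. excess n a x = excess n b y) \<longleftrightarrow>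
    (\<exists>p q. p * q = (n - 1 - a - b) * (b - a) \<and> \<bar>q\<bar> < p \<and> (even (p + q) \<longleftrightarrow> odd n) \<and>
           p + q \<in> {n + 1 - 2 * a..n - 1} \<and> p - q \<in> {n + 1 - 2 * b..n - 1})"
    (is "?L \<longleftrightarrow> (\<exists>p q. ?R p q)")
proof
  assume ?L
  then obtain x y where xy: "x \<in> {1..a}" "y \<in> {1..b}" "excess n a x = excess n b y"
    by blast
  define p where "p = x + y + n - 1 - a - b"
  define q where "q = x - y + b - a"
  have sum: "p + q = 2 * x + n - 1 - 2 * a" and diff: "p - q = 2 * y + n - 1 - 2 * b"
    by (auto simp: p_def q_def)
  have "(p + q)\<^sup>2 - (p - q)\<^sup>2 = 4 * ((n - 1 - a - b) * (b - a))"
    using four_mul_excess_diff[of n a x b y] xy(3) unfolding sum diff by simp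
  then have "p * q = (n - 1 - a - b) * (b - a)"
    by (simp add: power2_eq_square algebra_simps)
  moreover have "\<bar>q\<bar> < p"
    using sum diff xy ab by auto
  moreover have "even (p + q) \<longleftrightarrow> odd n"
    unfolding sum by simp
  ultimately have "?R p q"
    using xy unfolding sum diff by auto
  then show "\<exists>p q. ?R p q" by blast
next
  assume "\<exists>p q. ?R p q"
  then obtain p q where pq: "?R p q" by blast
  then have "even (p + q - (n - 1 - 2 * a))" "even (p - q - (n - 1 - 2 * b))"
    by auto
  then obtain x y where x: "p + q - (n - 1 - 2 * a) = 2 * x" and y: "p - q - (n - 1 - 2 * b) = 2 * y"
    by (metis evenE)
  have sum: "2 * x + n - 1 - 2 * a = p + q" and diff: "2 * y + n - 1 - 2 * b = p - q"
    using x y by auto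
  have "4 * (excess n a x - excess n b y) = (p + q)\<^sup>2 - (p - q)\<^sup>2 - 4 * (p * q)"
    using four_mul_excess_diff[of n a x b y] pq unfolding sum diff by simp
  also have "\<dots> = 0"
    by (simp add: power2_eq_square algebra_simps)
  finally have "excess n a x = excess n b y" by simp
  moreover have "x \<in> {1..a}" "y \<in> {1..b}"
    using pq sum diff by auto
  ultimately show ?L by blast
qed

text \<open>
  The factorisation is determined by its larger factor \<open>p\<close>, with \<open>q = \<alpha> div p\<close>.  The bounds on
  \<open>p - q\<close> are bounds on \<open>p + (- q)\<close>, and \<open>p * (- q) = - \<alpha>\<close> explains why the second path enters
  through \<open>g\<close> at \<open>- \<alpha>\<close>.
\<close>

lemma collision_iff_divisor:
  fixes n a b :: nat and \<alpha> \<beta> :: int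
  assumes ab: "2 * a < n" "2 * b < n"
    and \<alpha>: "\<alpha> = (int n - 1 - int a - int b) * (int b - int a)"
    and \<beta>: "\<beta> = - \<alpha>"
  shows "(\<exists>x\<in>{1..a}. \<exists>y\<in>{1..b}.
            excess (int n) (int a) (int x) = excess (int n) (int b) (int y)) \<longleftrightarrow>
    (\<exists>p::nat. p > 0 \<and> int p dvd \<alpha> \<and> real p > sqrt \<bar>real_of_int \<alpha>\<bar> \<and>
          ((even (int p) \<longleftrightarrow> even (\<alpha> div int p)) \<longleftrightarrow> \<not> 2 dvd n) \<and>
          (g \<alpha> (real n + 1 - 2 * real a) \<le> ereal (real p) \<and>
           ereal (real p) \<le> g \<alpha> (real n - 1)) \<and>
          (g \<beta> (real n + 1 - 2 * real b) \<le> ereal (real p) \<and>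
           ereal (real p) \<le> g \<beta> (real n - 1)))"
    (is "?L \<longleftrightarrow> (\<exists>p. ?R p)")
proof -
  let ?F = "\<lambda>p q. p * q = \<alpha> \<and> \<bar>q\<bar> < p \<and> (even (p + q) \<longleftrightarrow> odd (int n)) \<and>
           p + q \<in> {int n + 1 - 2 * int a..int n - 1} \<and>
           p - q \<in> {int n + 1 - 2 * int b..int n - 1}"
  have cond: "?R p \<longleftrightarrow> ?F (int p) q" if p: "p > 0" and pq: "int p * q = \<alpha>" for p q
  proof -
    define r where "r = real_of_int q"
    have \<alpha>r: "real_of_int \<alpha> = real p * r" and \<beta>r: "real_of_int \<beta> = real p * (- r)"
      using pq \<beta> by (auto simp: r_def)
    have sqrt: "real p > sqrt \<bar>real_of_int \<alpha>\<bar> \<longleftrightarrow> \<bar>r\<bar> < real p"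
      using sqrt_abs_mult_less_iff[of "real p" r] p unfolding \<alpha>r by simp
    have size: "\<bar>r\<bar> < real p \<longleftrightarrow> \<bar>q\<bar> < int p"
      unfolding r_def by linarith
    have quot: "int p dvd \<alpha>" "\<alpha> div int p = q"
      using pq p by auto
    show ?thesis
    proof (cases "\<bar>r\<bar> < real p")
      case small: True
      have small': "\<bar>- r\<bar> < real p" using small by simp
      have "real n + 1 - 2 * real a \<le> real p + r \<longleftrightarrow> int n + 1 - 2 * int a \<le> int p + q"
        "real p + r \<le> real n - 1 \<longleftrightarrow> int p + q \<le> int n - 1"
        "real n + 1 - 2 * real b \<le> real p + - r \<longleftrightarrow> int n + 1 - 2 * int b \<le> int p - q"
        "real p + - r \<le> real n - 1 \<longleftrightarrow> int p - q \<le> int n - 1"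
        unfolding r_def by linarith+
      then show ?thesis
        unfolding sqrt unfolding \<alpha>r \<beta>r g_le_iff[OF small] g_le_iff[OF small']
          le_g_iff[OF small] le_g_iff[OF small'] quot(2)
        using p pq quot(1) small size by auto
    next
      case False
      then show ?thesis using sqrt size by simp
    qed
  qed
  have "?L \<longleftrightarrow> (\<exists>x\<in>{1..int a}. \<exists>y\<in>{1..int b}. excess (int n) (int a) x = excess (int n) (int b) y)"
    (is "_ \<longleftrightarrow> ?L'")
  proof
    assume ?L
    then obtain x y where "x \<in> {1..a}" "y \<in> {1..b}"
      "excess (int n) (int a) (int x) = excess (int n) (int b) (int y)" by blast
    then show ?L'
      by (intro bexI[of _ "int x"] bexI[of _ "int y"]) auto
  next
    assume ?L'
    then obtain x y where "x \<in> {1..int a}" "y \<in> {1..int b}"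
      "excess (int n) (int a) x = excess (int n) (int b) y" by blast
    then show ?L
      by (intro bexI[of _ "nat x"] bexI[of _ "nat y"]) auto
  qed
  also have "\<dots> \<longleftrightarrow> (\<exists>p q. ?F p q)"
    unfolding \<alpha> by (rule collision_iff_factorisation) (use ab in auto)
  also have "\<dots> \<longleftrightarrow> (\<exists>p. ?R p)"
  proof
    assume "\<exists>p q. ?F p q"
    then obtain p q where F: "?F p q" by blast
    then have p: "int (nat p) = p" "nat p > 0" by auto
    have "?R (nat p)"
      by (rule iffD2[OF cond[of _ q]]) (use F p in auto)
    then show "\<exists>p. ?R p" by blast
  next
    assume "\<exists>p. ?R p"
    then obtain p where R: "?R p" by blast
    have "?F (int p) (\<alpha> div int p)"
      by (rule iffD1[OF cond R]) (use R in auto)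
    then show "\<exists>p q. ?F p q" by blast
  qed
  finally show ?thesis .
qed

lemma inj_vertex_excess_iff:
  assumes pos: "\<And>i. i \<in> {1..k} \<Longrightarrow> A i \<ge> 1"
    and n: "n = 1 + (\<Sum>i=1..k. A i)"
  shows "inj_on (vertex_excess n A) (pverts (starlike k A)) \<longleftrightarrow>
    inj_on A {1..k} \<and> (\<forall>i\<in>{1..k}. 2 * A i < n) \<and>
    (\<forall>i\<in>{1..k}. \<forall>j\<in>{1..k}. i < j \<longrightarrow>
      \<not> (\<exists>x\<in>{1..A i}. \<exists>y\<in>{1..A j}.
          excess (int n) (int (A i)) (int x) = excess (int n) (int (A j)) (int y)))"
    (is "?inj \<longleftrightarrow> ?distinct \<and> ?short \<and> ?separate")
proof
  let ?V = "pverts (starlike k A)"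
  have V: "Pend i x \<in> ?V \<longleftrightarrow> i \<in> {1..k} \<and> x \<in> {1..A i}" "Centre \<in> ?V" for i x
    by (auto simp: starlike_def)
  assume inj: ?inj
  have ?distinct
  proof (rule inj_onI)
    fix i j assume ij: "i \<in> {1..k}" "j \<in> {1..k}" "A i = A j"
    \<comment> \<open>Paths of equal length have equal excess at each depth, and depth \<open>1\<close> always exists.\<close>
    have "Pend i 1 = Pend j 1"
      by (rule inj_onD[OF inj]) (use ij pos in \<open>auto simp: V\<close>)
    then show "i = j" by simp
  qed
  moreover have ?short
  proof (rule ballI, rule ccontr)
    fix i assume i: "i \<in> {1..k}" and long: "\<not> 2 * A i < n"
    have "A i \<le> (\<Sum>i=1..k. A i)"
      using i by (intro member_le_sum) auto
    \<comment> \<open>The other zero of the excess, besides depth \<open>0\<close>; it is a depth on the path as \<open>A i < n\<close>.\<close>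
    define x where "x = 2 * A i + 1 - n"
    have "Centre = Pend i x"
    proof (rule inj_onD[OF inj])
      show "vertex_excess n A Centre = vertex_excess n A (Pend i x)"
        using long by (simp add: x_def excess_def of_nat_diff)
      show "Pend i x \<in> ?V"
        using i long \<open>A i \<le> _\<close> n by (auto simp: V x_def)
    qed (simp add: V)
    then show False by simp
  qed
  moreover have ?separate
  proof (intro ballI impI notI)
    fix i j assume ij: "i \<in> {1..k}" "j \<in> {1..k}" "i < j"
      and "\<exists>x\<in>{1..A i}. \<exists>y\<in>{1..A j}.
          excess (int n) (int (A i)) (int x) = excess (int n) (int (A j)) (int y)"
    then obtain x y where "x \<in> {1..A i}" "y \<in> {1..A j}"
      "excess (int n) (int (A i)) (int x) = excess (int n) (int (A j)) (int y)" by blast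
    then have "Pend i x = Pend j y"
      by (intro inj_onD[OF inj]) (use ij in \<open>auto simp: V\<close>)
    with ij show False by simp
  qed
  ultimately show "?distinct \<and> ?short \<and> ?separate" by blast
next
  let ?V = "pverts (starlike k A)"
  assume R: "?distinct \<and> ?short \<and> ?separate"
  have inj: "x = y"
    if "i \<in> {1..k}" "excess (int n) (int (A i)) (int x) = excess (int n) (int (A i)) (int y)" for i x y
    using excess_inj[of "int (A i)" "int n" "int x" "int y"] R that by fastforce
  show ?inj
  proof (rule inj_onI)
    fix u v assume uv: "u \<in> ?V" "v \<in> ?V" "vertex_excess n A u = vertex_excess n A v"
    \<comment> \<open>The centre plays the part of depth \<open>0\<close> on every path.\<close>
    have centre: False if "i \<in> {1..k}" "1 \<le> x" "excess (int n) (int (A i)) (int x) = 0" for i x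
      using inj[of i x 0] that by (simp add: excess_def)
    show "u = v"
    proof (cases u; cases v)
      fix i x j y assume Pend: "u = Pend i x" "v = Pend j y"
      with uv have ij: "i \<in> {1..k}" "j \<in> {1..k}" "x \<in> {1..A i}" "y \<in> {1..A j}"
        and eq: "excess (int n) (int (A i)) (int x) = excess (int n) (int (A j)) (int y)"
        by (auto simp: starlike_def)
      have "\<not> i < j" using R ij eq by blast
      moreover have "\<not> j < i" using R ij eq[symmetric] by blast
      ultimately have "i = j" by simp
      with inj[of i x y] ij eq Pend show ?thesis by simp
    qed (use uv centre in \<open>force simp: starlike_def\<close>)+
  qed
qed


section \<open>The characterisation\<close>

theorem theorem6:
  fixes k n :: nat and A :: "nat \<Rightarrow> nat" and \<alpha> :: "nat \<Rightarrow> nat \<Rightarrow> int"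
  assumes "k \<ge> 3"
    and "\<And>i. i \<in> {1..k} \<Longrightarrow> A i \<ge> 1"
    and "n = 1 + (\<Sum>i=1..k. A i)"
    and "\<And>i j. i \<in> {1..k} \<Longrightarrow> j \<in> {1..k} \<Longrightarrow>
           \<alpha> i j = (int n - 1 - int (A i) - int (A j)) * (int (A j) - int (A i))"
  shows "transmission_irregular (starlike k A) \<longleftrightarrow>
    inj_on A {1..k} \<and>
    (\<forall>i\<in>{1..k}. real (A i) < real n / 2) \<and>
    (\<forall>i\<in>{1..k}. \<forall>j\<in>{1..k}. i < j \<longrightarrow>
      \<not> (\<exists>p::nat. p > 0 \<and> int p dvd \<alpha> i j \<and> real p > sqrt \<bar>real_of_int (\<alpha> i j)\<bar> \<and>
          ((even (int p) \<longleftrightarrow> even (\<alpha> i j div int p)) \<longleftrightarrow> \<not> 2 dvd n) \<and>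
          (g (\<alpha> i j) (real n + 1 - 2 * real (A i)) \<le> ereal (real p) \<and>
           ereal (real p) \<le> g (\<alpha> i j) (real n - 1)) \<and>
          (g (\<alpha> j i) (real n + 1 - 2 * real (A j)) \<le> ereal (real p) \<and>
           ereal (real p) \<le> g (\<alpha> j i) (real n - 1))))"
    (is "_ \<longleftrightarrow> _ \<and> ?short \<and> (\<forall>i\<in>_. \<forall>j\<in>_. _ \<longrightarrow> \<not> ?divisor i j)")
proof -
  let ?collision = "\<lambda>i j. \<exists>x\<in>{1..A i}. \<exists>y\<in>{1..A j}.
    excess (int n) (int (A i)) (int x) = excess (int n) (int (A j)) (int y)"
  have short: "?short \<longleftrightarrow> (\<forall>i\<in>{1..k}. 2 * A i < n)"
    by (rule ball_cong) auto
  have collision: "?collision i j \<longleftrightarrow> ?divisor i j"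
    if "\<forall>i\<in>{1..k}. 2 * A i < n" "i \<in> {1..k}" "j \<in> {1..k}" for i j
  proof (rule collision_iff_divisor)
    show "\<alpha> j i = - \<alpha> i j"
      using assms(4)[of i j] assms(4)[of j i] that by (simp add: algebra_simps)
  qed (use that assms(4) in auto)
  have "transmission_irregular (starlike k A) \<longleftrightarrow>
      inj_on A {1..k} \<and> (\<forall>i\<in>{1..k}. 2 * A i < n) \<and>
      (\<forall>i\<in>{1..k}. \<forall>j\<in>{1..k}. i < j \<longrightarrow> \<not> ?collision i j)"
    using transmission_irregular_iff_excess[OF assms(3)] inj_vertex_excess_iff[OF assms(2,3)]
    by simp
  also have "\<dots> \<longleftrightarrow> inj_on A {1..k} \<and> (\<forall>i\<in>{1..k}. 2 * A i < n) \<and>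
      (\<forall>i\<in>{1..k}. \<forall>j\<in>{1..k}. i < j \<longrightarrow> \<not> ?divisor i j)"
    by (intro conj_cong refl ball_cong imp_cong arg_cong[where f = Not] collision)
  finally show ?thesis
    unfolding short .
qed

end
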